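(* Let $(\Omega,\mathcal{F},P)$ be a complete and nonatomic probability space, let $\Xi$ be a separable metric space equipped with its Borel $\sigma$-algebra $\mathcal{B}(\Xi)$, let $\xi\colon\Omega\to\Xi$ be a random element, and let $p\in[1,+\infty)$ and $\varepsilon\ge 0$. Let $X$ be a compact metric space. Suppose that: (1) $F\colon X\times\Xi\to\mathbb{R}$ is a Carathéodory function; (2) the map $x\mapsto F_x(\xi):=F(x,\xi)$ from $X$ to $\mathcal{L}^p(\Omega,\mathcal{F},P)$ is continuous; (3) there is a random variable $\kappa\colon\Xi\to\mathbb{R}$ with $\kappa\circ\xi\in\mathcal{L}^{p+\varepsilon}(\Omega,\mathcal{F},P)$ and $|F(x,\xi)|\le\kappa(\xi)$ for each $x\in X$ and each (deterministic) $\xi\in\Xi$; (4) $\rho\colon\mathcal{L}^p(\Omega,\mathcal{F},P)\to\mathbb{R}$ is a convex, law invariant, and Lipschitz continuous risk measure; (5) $(\xi^i)_{i\in\mathbb{N}}$ is a sequence of $\Xi$-valued random elements defined on a probability space $(\Theta,\mathcal{A},\mathbb{P})$ such that for each random variable $\vartheta\colon\Xi\to\mathbb{R}$ with $\vartheta\circ\xi\in\mathcal{L}^{1+\varepsilon/p}(\Omega,\mathcal{F},P)$, $$\frac1N\sum_{i=1}^N\vartheta(\xi^i(\theta))\to\int_\Omega\vartheta\circ\xi\,\mathrm{d}P\quad\text{as }N\to\infty\quad\text{for }\mathbb{P}\text{-almost all }\theta\in\Theta.$$ For $N\in\mathbb{N}$ and $\theta\in\Theta$ let $\nu_{N,\theta}:=\frac1N\sum_{i=1}^N\delta_{\xi^i(\theta)}$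 be the empirical probability measure on $(\Xi,\mathcal{B}(\Xi))$. Then, for $\mathbb{P}$-almost all $\theta\in\Theta$, $$\sup_{x\in X}\,\bigl|\rho(\nu_{N,\theta}\circ F_x^{-1})-\rho(F_x(\xi))\bigr|\to 0\quad\text{as }N\to\infty.$$
   Context: **Nonatomic.** $(\Omega,\mathcal{F},P)$ is called nonatomic if there exists a random variable $U\colon\Omega\to(0,1)$ with $U\sim\mathrm{Uniform}(0,1)$. **Random variables on $\Xi$.** A random variable $Z\colon\Xi\to\mathbb{R}$ is a Borel measurable map. $F_x$ denotes the map $\xi\mapsto F(x,\xi)$ on $\Xi$. For a probability measure $\nu$ on $\Xi$, $\nu\circ Z^{-1}$ is the pushforward of $\nu$ under $Z$, a probability measure on $\mathbb{R}$. $\delta_z$ is the Dirac measure at $z$. The symbol $\xi$ denotes both the random element and deterministic elements of $\Xi$. **Carathéodory function.** $G\colon X\times\Xi\to\mathbb{R}$ is Carathéodory if $G(x,\cdot)$ is Borel measurable for each $x\in X$ and $G(\cdot,\upsilon)$ is continuous for each $\upsilon\in\Xi$. **Risk measures.** A functional $\rho\colon\mathcal{L}^p(\Omega,\mathcal{F},P)\to\mathbb{R}$ is law invariant if $\rho(Y)=\rho(Z)$ whenever $Y,Z\in\mathcal{L}^p(\Omega,\mathcal{F},P)$ have the same distribution. A risk measure $\rho$ is convex if it is a convex function, monotone ($V\ge W$ almost surely implies $\rho(V)\ge\rho(W)$), and translation equivariant ($\rho(V+a)=\rho(V)+a$ for all $a\in\mathbb{R}$). Lipschitz continuity is with respect to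 the $\mathcal{L}^p$ norm. **Risk measures of distributions.** Since $(\Omega,\mathcal{F},P)$ is nonatomic, every probability distribution $Q$ on $\mathbb{R}$ is the distribution of some random variable on $\Omega$ (e.g. $H_Q(U)$, where $H_Q$ is the quantile function of $Q$). For $Q$ with finite $p$th moment, $\rho(Q)$ denotes the common value $\rho(Y)$ over all $Y\in\mathcal{L}^p(\Omega,\mathcal{F},P)$ with distribution $Q$. *)

theory Defs
  imports "HOL-Probability.Probability"
begin

definition nonatomic :: "'w measure \<Rightarrow> bool" where
  "nonatomic M \<longleftrightarrow>
     (\<exists>U\<in>borel_measurable M. (\<forall>\<omega>\<in>space M. U \<omega> \<in> {0<..<1}) \<and>
        distr M borel U = uniform_measure lborel {0<..<(1::real)})"

(* Elements of the space are functions, not almost-everywhere classes. *)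
definition lp_space :: "'w measure \<Rightarrow> real \<Rightarrow> ('w \<Rightarrow> real) set" where
  "lp_space M p = {Y \<in> borel_measurable M. integrable M (\<lambda>\<omega>. \<bar>Y \<omega>\<bar> powr p)}"

definition lp_norm :: "'w measure \<Rightarrow> real \<Rightarrow> ('w \<Rightarrow> real) \<Rightarrow> real" where
  "lp_norm M p Y = (\<integral>\<omega>. \<bar>Y \<omega>\<bar> powr p \<partial>M) powr (1 / p)"

definition lp_continuous_on ::
    "'w measure \<Rightarrow> real \<Rightarrow> 'x::metric_space set \<Rightarrow> ('x \<Rightarrow> 'w \<Rightarrow> real) \<Rightarrow> bool" where
  "lp_continuous_on M p X G \<longleftrightarrow>
     (\<forall>x\<in>X. G x \<in> lp_space M p) \<and>
     (\<forall>x\<in>X. ((\<lambda>y. lp_norm M p (\<lambda>\<omega>. G y \<omega> - G x \<omega>)) \<longlongrightarrow> 0) (at x within X))"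

definition caratheodory ::
    "'x::metric_space set \<Rightarrow> ('x \<Rightarrow> 's::metric_space \<Rightarrow> real) \<Rightarrow> bool" where
  "caratheodory X G \<longleftrightarrow>
     (\<forall>x\<in>X. G x \<in> borel_measurable borel) \<and> (\<forall>\<upsilon>. continuous_on X (\<lambda>x. G x \<upsilon>))"

(* In the following definitions a functional on the p-th Lebesgue space is a total
   function whose values outside lp_space M p are irrelevant. *)

definition law_invariant :: "'w measure \<Rightarrow> real \<Rightarrow> (('w \<Rightarrow> real) \<Rightarrow> real) \<Rightarrow> bool" where
  "law_invariant M p \<rho> \<longleftrightarrow>
     (\<forall>Y\<in>lp_space M p. \<forall>Z\<in>lp_space M p. distr M borel Y = distr M borel Z \<longrightarrow> \<rho> Y = \<rho> Z)"

definition convex_risk_measure :: "'w measure \<Rightarrow> real \<Rightarrow> (('w \<Rightarrow> real) \<Rightarrow> real) \<Rightarrow> bool" where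
  "convex_risk_measure M p \<rho> \<longleftrightarrow>
     (\<forall>V\<in>lp_space M p. \<forall>W\<in>lp_space M p. \<forall>t\<in>{0..1}.
        \<rho> (\<lambda>\<omega>. t * V \<omega> + (1 - t) * W \<omega>) \<le> t * \<rho> V + (1 - t) * \<rho> W) \<and>
     (\<forall>V\<in>lp_space M p. \<forall>W\<in>lp_space M p. (AE \<omega> in M. V \<omega> \<ge> W \<omega>) \<longrightarrow> \<rho> V \<ge> \<rho> W) \<and>
     (\<forall>V\<in>lp_space M p. \<forall>a. \<rho> (\<lambda>\<omega>. V \<omega> + a) = \<rho> V + a)"

definition lp_lipschitz :: "'w measure \<Rightarrow> real \<Rightarrow> (('w \<Rightarrow> real) \<Rightarrow> real) \<Rightarrow> bool" where
  "lp_lipschitz M p \<rho> \<longleftrightarrow>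
     (\<exists>L\<ge>0. \<forall>V\<in>lp_space M p. \<forall>W\<in>lp_space M p.
        \<bar>\<rho> V - \<rho> W\<bar> \<le> L * lp_norm M p (\<lambda>\<omega>. V \<omega> - W \<omega>))"

(* The common value of rho over all p-integrable random variables with distribution Q.
   It is only meaningful if rho is law invariant and such a random variable exists. *)
definition risk_of_distribution ::
    "'w measure \<Rightarrow> real \<Rightarrow> (('w \<Rightarrow> real) \<Rightarrow> real) \<Rightarrow> real measure \<Rightarrow> real" where
  "risk_of_distribution M p \<rho> Q = (THE r. r \<in> \<rho> ` {Y \<in> lp_space M p. distr M borel Y = Q})"

lemma risk_of_distribution_distr:
  assumes "law_invariant M p \<rho>" "Y \<in> lp_space M p"
  shows "risk_of_distribution M p \<rho> (distr M borel Y) = \<rho> Y"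
  unfolding risk_of_distribution_def
proof (rule the_equality)
  show "\<rho> Y \<in> \<rho> ` {Z \<in> lp_space M p. distr M borel Z = distr M borel Y}"
    using assms(2) by blast
  show "r = \<rho> Y" if "r \<in> \<rho> ` {Z \<in> lp_space M p. distr M borel Z = distr M borel Y}" for r
    using that assms unfolding law_invariant_def by blast
qed

(* For N = 0 this is the null measure; the points are numbered from 1. *)
definition empirical_measure :: "nat \<Rightarrow> (nat \<Rightarrow> 's::metric_space) \<Rightarrow> 's measure" where
  "empirical_measure N s =
     measure_of UNIV (sets borel)
       (\<lambda>A. ennreal (1 / real N) * (\<Sum>i=1..N. emeasure (return borel (s i)) A))"

lemma sets_empirical_measure [simp, measurable_cong]:
  "sets (empirical_measure N s) = sets borel"
  unfolding empirical_measure_def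
  by (rule sets.sets_measure_of_eq[of borel, unfolded space_borel])

lemma space_empirical_measure [simp]: "space (empirical_measure N s) = UNIV"
  using sets_eq_imp_space_eq[OF sets_empirical_measure] by simp

lemma emeasure_empirical_measure:
  fixes s :: "nat \<Rightarrow> 's::metric_space"
  assumes "A \<in> sets borel"
  shows "emeasure (empirical_measure N s) A =
    ennreal (1 / real N) * (\<Sum>i=1..N. emeasure (return borel (s i)) A)"
proof (rule emeasure_measure_of[OF empirical_measure_def])
  show "sets borel \<subseteq> Pow (UNIV :: 's::metric_space set)" by simp
  show "A \<in> sets (empirical_measure N s)" using assms by simp
  show "positive (sets (empirical_measure N s))
      (\<lambda>A. ennreal (1 / real N) * (\<Sum>i=1..N. emeasure (return borel (s i)) A))"
    by (simp add: positive_def)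
  show "countably_additive (sets (empirical_measure N s))
      (\<lambda>A. ennreal (1 / real N) * (\<Sum>i=1..N. emeasure (return borel (s i)) A))"
  proof (rule countably_additiveI)
    fix B :: "nat \<Rightarrow> 's set"
    assume B: "range B \<subseteq> sets (empirical_measure N s)" "disjoint_family B"
    have "(\<Sum>n. emeasure (return borel (s i)) (B n)) = emeasure (return borel (s i)) (\<Union>(range B))" for i
      using B by (intro suminf_emeasure) auto
    then show "(\<Sum>n. ennreal (1 / real N) * (\<Sum>i=1..N. emeasure (return borel (s i)) (B n))) =
        ennreal (1 / real N) * (\<Sum>i=1..N. emeasure (return borel (s i)) (\<Union>(range B)))"
      by (simp add: suminf_sum del: emeasure_return)
  qed
qed

lemma prob_space_empirical_measure:
  assumes "N > 0"
  shows "prob_space (empirical_measure N s)"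
proof (rule prob_spaceI)
  have "emeasure (empirical_measure N s) UNIV = ennreal (1 / real N) * ennreal (real N)"
    by (simp add: emeasure_empirical_measure ennreal_of_nat_eq_real_of_nat)
  also have "\<dots> = 1"
    using assms by (subst ennreal_mult[symmetric]) auto
  finally show "emeasure (empirical_measure N s) (space (empirical_measure N s)) = 1"
    by simp
qed

end

(* Let T_N = xi^J with J uniform on {1..N}, built on the nonatomic space. Its law is the empirical
   measure, so the empirical risk of f is rho(f(T_N)), and the p-th power of the distance between
   f(T_N) and g(T_N) in the p-th Lebesgue space is the empirical mean of |f - g|^p. Around every
   point x of X there is a ball on which all F_y are within |F_y - g|^p <= phi of one simple
   function g, where phi(xi) has small mean; by the law of large numbers the empirical mean of phi
   is eventually small too, and Lipschitz continuity reduces everything to g. The law of g under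
   the empirical measure has finite support and converges atom by atom, and rho is continuous along
   such laws by a quantile coupling. Compactness of X makes the estimate uniform. *)
theory Submission
  imports Defs
begin

section \<open>Couplings on a nonatomic space\<close>

text \<open>The uniform law is recorded through half-open intervals because the events met below
  have this shape: sublevel sets of a quantile function, cells of an equal partition, left
  neighbourhoods of a point.\<close>

definition unit_uniform :: "'w measure \<Rightarrow> ('w \<Rightarrow> real) \<Rightarrow> bool" where
  "unit_uniform M U \<longleftrightarrow> U \<in> borel_measurable M \<and> (\<forall>\<omega>\<in>space M. 0 < U \<omega> \<and> U \<omega> < 1) \<and>
     (\<forall>a b. 0 \<le> a \<longrightarrow> a \<le> b \<longrightarrow> b \<le> 1 \<longrightarrow>
        emeasure M {\<omega>\<in>space M. a < U \<omega> \<and> U \<omega> \<le> b} = ennreal (b - a))"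

lemma nonatomic_imp_unit_uniform:
  assumes "nonatomic M"
  shows "\<exists>U. unit_uniform M U"
proof -
  obtain U where [measurable]: "U \<in> borel_measurable M"
    and rng: "\<And>\<omega>. \<omega> \<in> space M \<Longrightarrow> U \<omega> \<in> {0<..<1}"
    and dU: "distr M borel U = uniform_measure lborel {0<..<(1::real)}"
    using assms unfolding nonatomic_def by blast
  have "emeasure M {\<omega>\<in>space M. a < U \<omega> \<and> U \<omega> \<le> b} = ennreal (b - a)"
    if ab: "0 \<le> a" "a \<le> b" "b \<le> 1" for a b
  proof -
    have "emeasure M {\<omega>\<in>space M. a < U \<omega> \<and> U \<omega> \<le> b} = emeasure (distr M borel U) {a<..b}"
      by (auto simp: emeasure_distr intro!: arg_cong[where f="emeasure M"])
    also have "\<dots> = emeasure lborel ({0<..<1} \<inter> {a<..b})"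
      unfolding dU by (simp add: divide_ennreal_def)
    \<comment> \<open>As \<open>0 \<le> a\<close> and \<open>b \<le> 1\<close>, the two sets differ
      at most in the point 1.\<close>
    also have "\<dots> = emeasure lborel {a<..b}"
    proof (rule emeasure_eq_AE)
      show "AE x in lborel. x \<in> {0<..<1} \<inter> {a<..b} \<longleftrightarrow> x \<in> {a<..b}"
        using AE_lborel_singleton[of "1::real"] by eventually_elim (use ab in auto)
    qed auto
    also have "\<dots> = ennreal (b - a)"
      using ab by simp
    finally show ?thesis .
  qed
  then show ?thesis
    using rng unfolding unit_uniform_def by (intro exI[of _ U]) auto
qed

text \<open>Inverse transform sampling. On levels in (0,1) the quantile function and
  \<open>cdf Q\<close> form a Galois connection, so \<open>?Y \<omega> \<le> x\<close> means
  \<open>U \<omega> \<le> cdf Q x\<close>, an event of probability \<open>cdf Q x\<close>.\<close>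

lemma distr_quantile:
  assumes "prob_space M" "unit_uniform M U"
    and "real_distribution Q"
  shows "(\<lambda>\<omega>. Inf {x. U \<omega> \<le> cdf Q x}) \<in> borel_measurable M" (is "?Y \<in> _")
    and "distr M borel (\<lambda>\<omega>. Inf {x. U \<omega> \<le> cdf Q x}) = Q"
proof -
  interpret prob_space M by fact
  interpret Q: cdf_distribution Q
    unfolding cdf_distribution_def by fact
  have [measurable]: "U \<in> borel_measurable M"
    and U0: "\<And>\<omega>. \<omega> \<in> space M \<Longrightarrow> 0 < U \<omega>"
    and U1: "\<And>\<omega>. \<omega> \<in> space M \<Longrightarrow> U \<omega> < 1"
    and eU: "\<And>a b. 0 \<le> a \<Longrightarrow> a \<le> b \<Longrightarrow> b \<le> 1 \<Longrightarrow>
      emeasure M {\<omega>\<in>space M. a < U \<omega> \<and> U \<omega> \<le> b} = ennreal (b - a)"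
    using assms(2) unfolding unit_uniform_def by blast+
  \<comment> \<open>Measurability of the quantile function is known on the open unit interval, so
    \<open>U\<close> is first viewed as a map into that restricted space.\<close>
  have "U \<in> measurable M (restrict_space borel {0<..<1})"
    using U0 U1 by (intro measurable_restrict_space2) auto
  from measurable_compose[OF this Q.measurable_CI]
  show Ym[measurable]: "?Y \<in> borel_measurable M" .
  show "distr M borel ?Y = Q"
  proof (rule cdf_unique)
    show "real_distribution (distr M borel ?Y)"
      by (simp add: Ym)
    show "cdf (distr M borel ?Y) = cdf Q"
    proof
      fix x
      have "cdf (distr M borel ?Y) x = measure M {\<omega>\<in>space M. ?Y \<omega> \<le> x}"
        by (subst cdf_def, subst measure_distr) (auto intro!: arg_cong[where f="measure M"])
      \<comment> \<open>The conjunct \<open>0 < U \<omega>\<close> brings the event into the form of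
        \<open>eU\<close> with left end 0.\<close>
      also have "{\<omega>\<in>space M. ?Y \<omega> \<le> x} = {\<omega>\<in>space M. 0 < U \<omega> \<and> U \<omega> \<le> cdf Q x}"
        using Q.pseudoinverse[OF U0 U1, symmetric] U0 by auto
      also have "measure M \<dots> = cdf Q x"
        using eU[of 0 "cdf Q x"] Q.cdf_nonneg[of x] Q.cdf_bounded_prob[of x]
        by (simp add: measure_def)
      finally show "cdf (distr M borel ?Y) x = cdf Q x" .
    qed
  qed fact
qed

text \<open>The unit interval is cut into \<open>N\<close> cells ((i-1)/N, i/N] of equal length; the
  index is the number of the cell that contains a uniform variable.\<close>

lemma exists_uniform_index:
  assumes "nonatomic M" "0 < (N::nat)"
  shows "\<exists>J\<in>measurable M (count_space UNIV). (\<forall>\<omega>\<in>space M. J \<omega> \<in> {1..N}) \<and>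
    (\<forall>i\<in>{1..N}. emeasure M {\<omega>\<in>space M. J \<omega> = i} = ennreal (1 / real N))"
proof -
  obtain U where U: "unit_uniform M U"
    using nonatomic_imp_unit_uniform[OF assms(1)] by blast
  have [measurable]: "U \<in> borel_measurable M"
    and U0: "\<And>\<omega>. \<omega> \<in> space M \<Longrightarrow> 0 < U \<omega>"
    and U1: "\<And>\<omega>. \<omega> \<in> space M \<Longrightarrow> U \<omega> < 1"
    and eU: "\<And>a b. 0 \<le> a \<Longrightarrow> a \<le> b \<Longrightarrow> b \<le> 1 \<Longrightarrow>
      emeasure M {\<omega>\<in>space M. a < U \<omega> \<and> U \<omega> \<le> b} = ennreal (b - a)"
    using U unfolding unit_uniform_def by blast+
  define J where "J \<omega> = nat \<lceil>real N * U \<omega>\<rceil>" for \<omega>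
  show ?thesis
  proof (intro bexI[of _ J] conjI ballI)
    show "J \<in> measurable M (count_space UNIV)"
      unfolding J_def by measurable
    show "J \<omega> \<in> {1..N}" if \<omega>: "\<omega> \<in> space M" for \<omega>
    proof -
      have "0 < real N * U \<omega>" using U0[OF \<omega>] assms by simp
      moreover have "real N * U \<omega> \<le> real N"
        using U1[OF \<omega>] assms mult_left_mono[of "U \<omega>" 1 "real N"] by simp
      ultimately have "1 \<le> \<lceil>real N * U \<omega>\<rceil>" "\<lceil>real N * U \<omega>\<rceil> \<le> int N"
        by (simp_all add: le_ceiling_iff ceiling_le_iff)
      then show ?thesis unfolding J_def by (auto simp: nat_le_iff le_nat_iff)
    qed
    fix i assume i: "i \<in> {1..N}"
    have "J \<omega> = i \<longleftrightarrow> (real i - 1) / real N < U \<omega> \<and> U \<omega> \<le> real i / real N" for \<omega>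
    proof -
      have "J \<omega> = i \<longleftrightarrow> \<lceil>real N * U \<omega>\<rceil> = int i"
        using i unfolding J_def by auto
      also have "\<dots> \<longleftrightarrow> real i - 1 < real N * U \<omega> \<and> real N * U \<omega> \<le> real i"
        by (simp add: ceiling_eq_iff)
      finally show ?thesis
        using assms by (simp add: field_simps)
    qed
    then show "emeasure M {\<omega>\<in>space M. J \<omega> = i} = ennreal (1 / real N)"
      using i eU[of "(real i - 1) / real N" "real i / real N"] assms
      by (simp add: divide_right_mono diff_divide_distrib)
  qed
qed

text \<open>\<open>T\<close> is the point \<open>s (J \<omega>)\<close> with a uniform index
  \<open>J\<close>. Drawing the index instead of the point copes with repetitions among the
  \<open>s i\<close>, since the events \<open>J \<omega> = i\<close> are disjoint in any case. The
  integral formula holds for arbitrary \<open>h\<close> because \<open>h (T \<omega>)\<close> is a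
  finite combination of indicators of these events.\<close>

lemma empirical_coupling:
  fixes s :: "nat \<Rightarrow> 's::metric_space"
  assumes "prob_space M" "nonatomic M" "0 < N"
  obtains T where "T \<in> measurable M borel" "distr M borel T = empirical_measure N s"
    "\<And>\<omega>. \<omega> \<in> space M \<Longrightarrow> T \<omega> \<in> s ` {1..N}"
    "\<And>h. (\<integral>\<omega>. h (T \<omega>) \<partial>M) = (1 / real N) * (\<Sum>i=1..N. h (s i) :: real)"
proof -
  interpret prob_space M by fact
  obtain J where Jm[measurable]: "J \<in> measurable M (count_space UNIV)"
    and J: "\<And>\<omega>. \<omega> \<in> space M \<Longrightarrow> J \<omega> \<in> {1..N}"
    and eJ: "\<And>i. i \<in> {1..N} \<Longrightarrow> emeasure M {\<omega>\<in>space M. J \<omega> = i} = ennreal (1 / real N)"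
    using exists_uniform_index[OF assms(2,3)] by blast
  have Tm[measurable]: "(\<lambda>\<omega>. s (J \<omega>)) \<in> measurable M borel"
    by (rule measurable_compose[OF Jm]) simp
  show thesis
  proof (rule that[of "\<lambda>\<omega>. s (J \<omega>)"])
    show "distr M borel (\<lambda>\<omega>. s (J \<omega>)) = empirical_measure N s"
    proof (rule measure_eqI)
      fix A assume "A \<in> sets (distr M borel (\<lambda>\<omega>. s (J \<omega>)))"
      then have A[measurable]: "A \<in> sets borel" by simp
      have "emeasure (distr M borel (\<lambda>\<omega>. s (J \<omega>))) A =
          emeasure M (\<Union>i\<in>{i\<in>{1..N}. s i \<in> A}. {\<omega>\<in>space M. J \<omega> = i})"
        using J by (subst emeasure_distr) (auto intro!: arg_cong[where f="emeasure M"])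
      also have "\<dots> = (\<Sum>i\<in>{i\<in>{1..N}. s i \<in> A}. emeasure M {\<omega>\<in>space M. J \<omega> = i})"
        by (rule sum_emeasure[symmetric]) (auto simp: disjoint_family_on_def)
      also have "\<dots> = (\<Sum>i\<in>{i\<in>{1..N}. s i \<in> A}. ennreal (1 / real N))"
        by (rule sum.cong) (auto simp: eJ)
      also have "\<dots> = (\<Sum>i=1..N. ennreal (1 / real N) * indicator A (s i))"
        by (rule sum.mono_neutral_cong_left) (auto simp: indicator_def)
      also have "\<dots> = emeasure (empirical_measure N s) A"
        by (simp add: emeasure_empirical_measure sum_distrib_left)
      finally show "emeasure (distr M borel (\<lambda>\<omega>. s (J \<omega>))) A = emeasure (empirical_measure N s) A" .
    qed simp
    fix h :: "'s \<Rightarrow> real"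
    have "(\<integral>\<omega>. h (s (J \<omega>)) \<partial>M) = (\<integral>\<omega>. (\<Sum>i=1..N. indicator {\<omega>\<in>space M. J \<omega> = i} \<omega> * h (s i)) \<partial>M)"
    proof (rule Bochner_Integration.integral_cong)
      fix \<omega> assume \<omega>: "\<omega> \<in> space M"
      have "(\<Sum>i=1..N. indicator {\<omega>\<in>space M. J \<omega> = i} \<omega> * h (s i)) =
          (\<Sum>i=1..N. if J \<omega> = i then h (s i) else 0)"
        using \<omega> by (intro sum.cong) (auto simp: indicator_def)
      also have "\<dots> = h (s (J \<omega>))"
        using J[OF \<omega>] by simp
      finally show "h (s (J \<omega>)) = (\<Sum>i=1..N. indicator {\<omega>\<in>space M. J \<omega> = i} \<omega> * h (s i))" ..
    qed simp
    also have "\<dots> = (\<Sum>i=1..N. (\<integral>\<omega>. indicator {\<omega>\<in>space M. J \<omega> = i} \<omega> * h (s i) \<partial>M))"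
      by (rule Bochner_Integration.integral_sum) (auto simp: emeasure_eq_measure)
    also have "\<dots> = (\<Sum>i=1..N. (1 / real N) * h (s i))"
      by (rule sum.cong) (auto simp: eJ measure_def)
    finally show "(\<integral>\<omega>. h (s (J \<omega>)) \<partial>M) = (1 / real N) * (\<Sum>i=1..N. h (s i))"
      by (simp add: sum_distrib_left)
  qed (use J in auto)
qed


section \<open>Membership in Lebesgue spaces and bounds on the norm\<close>

lemma bounded_in_lp_space:
  assumes "prob_space M" "Y \<in> borel_measurable M" "\<And>\<omega>. \<omega> \<in> space M \<Longrightarrow> \<bar>Y \<omega>\<bar> \<le> B" "0 \<le> p"
  shows "Y \<in> lp_space M p"
proof -
  interpret prob_space M by fact
  note [measurable] = assms(2)
  have "integrable M (\<lambda>\<omega>. \<bar>Y \<omega>\<bar> powr p)"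
    using assms by (intro integrable_const_bound[where B="B powr p"]) (auto intro!: powr_mono2)
  then show ?thesis
    using assms unfolding lp_space_def by auto
qed

lemma lp_norm_tendsto_0:
  assumes "0 < p" "((\<lambda>n. \<integral>\<omega>. \<bar>Y n \<omega>\<bar> powr p \<partial>M) \<longlongrightarrow> 0) G"
  shows "((\<lambda>n. lp_norm M p (Y n)) \<longlongrightarrow> 0) G"
proof -
  have "((\<lambda>n. (\<integral>\<omega>. \<bar>Y n \<omega>\<bar> powr p \<partial>M) powr (1 / p)) \<longlongrightarrow> 0 powr (1 / p)) G"
    using assms by (intro tendsto_powr') auto
  then show ?thesis
    using assms by (simp add: lp_norm_def)
qed

lemma lp_norm_le:
  assumes "0 < p" "0 \<le> e" "(\<integral>\<omega>. \<bar>Y \<omega>\<bar> powr p \<partial>M) \<le> e powr p"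
  shows "lp_norm M p Y \<le> e"
proof -
  have "lp_norm M p Y \<le> (e powr p) powr (1 / p)"
    unfolding lp_norm_def using assms by (intro powr_mono2) auto
  also have "\<dots> = e"
    using assms by (simp add: powr_powr)
  finally show ?thesis .
qed

section \<open>Continuity of the risk along laws with a common finite support\<close>

text \<open>An atom at \<open>c\<close> would lie in every interval (c-d, c], whose mass
  \<open>d\<close> can be made smaller than that of the atom.\<close>

lemma unit_uniform_AE_neq:
  assumes "prob_space M" "unit_uniform M U"
  shows "AE \<omega> in M. U \<omega> \<noteq> c"
proof -
  interpret prob_space M by fact
  have [measurable]: "U \<in> borel_measurable M"
    and U: "\<And>\<omega>. \<omega> \<in> space M \<Longrightarrow> 0 < U \<omega> \<and> U \<omega> < 1"
    and eU: "\<And>a b. 0 \<le> a \<Longrightarrow> a \<le> b \<Longrightarrow> b \<le> 1 \<Longrightarrow>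
      emeasure M {\<omega>\<in>space M. a < U \<omega> \<and> U \<omega> \<le> b} = ennreal (b - a)"
    using assms(2) unfolding unit_uniform_def by blast+
  have "measure M {\<omega>\<in>space M. U \<omega> = c} = 0"
  proof (rule ccontr)
    assume *: "measure M {\<omega>\<in>space M. U \<omega> = c} \<noteq> 0"
    then have "{\<omega>\<in>space M. U \<omega> = c} \<noteq> {}"
      by (metis measure_empty)
    then have c: "0 < c" "c < 1"
      using U by auto
    \<comment> \<open>The bound by \<open>c\<close> keeps \<open>c - d\<close> nonnegative, and the
      half makes \<open>d\<close> strictly smaller than the supposed mass.\<close>
    define d where "d = min c (measure M {\<omega>\<in>space M. U \<omega> = c} / 2)"
    have d: "0 < d" "d \<le> c" "d < measure M {\<omega>\<in>space M. U \<omega> = c}"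
      using c * unfolding zero_less_measure_iff[symmetric] d_def by linarith+
    have "measure M {\<omega>\<in>space M. U \<omega> = c} \<le> measure M {\<omega>\<in>space M. c - d < U \<omega> \<and> U \<omega> \<le> c}"
      using d by (intro finite_measure_mono) auto
    also have "\<dots> = d"
      using eU[of "c - d" c] c d by (simp add: measure_def)
    finally show False using d by simp
  qed
  then show ?thesis
    by (subst AE_iff_measurable[OF _ refl]) (auto simp: emeasure_eq_measure)
qed

text \<open>Expresses all values of the cdf by masses of subsets of \<open>S\<close>, of which there
  are finitely many however \<open>x\<close> varies.\<close>

lemma cdf_finite_support:
  assumes "real_distribution Q" "finite S" "AE x in Q. x \<in> S"
  shows "cdf Q x = (\<Sum>a\<in>{a\<in>S. a \<le> x}. measure Q {a})"
proof -
  interpret real_distribution Q by fact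
  have "cdf Q x = measure Q {a\<in>S. a \<le> x}"
    unfolding cdf_def
  proof (rule finite_measure_eq_AE)
    show "AE y in Q. y \<in> {..x} \<longleftrightarrow> y \<in> {a\<in>S. a \<le> x}"
      using assms(3) by eventually_elim auto
  qed (use assms in \<open>auto intro!: borel_closed finite_imp_closed\<close>)
  also have "\<dots> = (\<Sum>a\<in>{a\<in>S. a \<le> x}. measure Q {a})"
    using assms by (intro finite_measure_eq_sum_singleton) auto
  finally show ?thesis .
qed

text \<open>The quantile functions of the \<open>Q n\<close> composed with a uniform variable agree eventually,
  almost surely, with that of \<open>Q\<close>: both depend only on which of the finitely many numbers
  \<open>measure Q A\<close>, \<open>A \<subseteq> S\<close>, lie above the uniform variable.\<close>
lemma risk_of_distribution_tendsto_finite_support: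
  fixes Q :: "nat \<Rightarrow> real measure"
  assumes "prob_space M" "nonatomic M" "1 \<le> p" "law_invariant M p \<rho>" "lp_lipschitz M p \<rho>"
    and Q: "\<And>n. real_distribution (Q n)" and Q': "real_distribution Q'"
    and S: "finite S" "\<And>n. AE x in Q n. x \<in> S" "AE x in Q'. x \<in> S"
    and lim: "\<And>a. a \<in> S \<Longrightarrow> (\<lambda>n. measure (Q n) {a}) \<longlonglongrightarrow> measure Q' {a}"
  shows "(\<lambda>n. risk_of_distribution M p \<rho> (Q n)) \<longlonglongrightarrow> risk_of_distribution M p \<rho> Q'"
proof -
  interpret prob_space M by fact
  obtain U where U: "unit_uniform M U"
    using nonatomic_imp_unit_uniform[OF assms(2)] by blast
  define Y where "Y n \<omega> = Inf {x. U \<omega> \<le> cdf (Q n) x}" for n \<omega>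
  define Z where "Z \<omega> = Inf {x. U \<omega> \<le> cdf Q' x}" for \<omega>
  have Ym[measurable]: "Y n \<in> borel_measurable M" and Yd: "distr M borel (Y n) = Q n" for n
    using distr_quantile[OF assms(1) U Q] unfolding Y_def[abs_def] by auto
  have Zm[measurable]: "Z \<in> borel_measurable M" and Zd: "distr M borel Z = Q'"
    using distr_quantile[OF assms(1) U Q'] unfolding Z_def[abs_def] by auto
  \<comment> \<open>Inserting 0 makes the maximum well defined and nonnegative for every finite
    \<open>S\<close>.\<close>
  define B where "B = Max (insert 0 (abs ` S))"
  have B: "\<bar>a\<bar> \<le> B" if "a \<in> S" for a
    unfolding B_def using S that by (intro Max_ge) auto
  have "0 \<le> B"
    unfolding B_def using S by (intro Max_ge) auto
  have Smeas[measurable]: "S \<in> sets borel"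
    using S by (intro borel_closed finite_imp_closed)
  have YS: "AE \<omega> in M. Y n \<omega> \<in> S" for n
    using S(2)[of n] unfolding Yd[symmetric] by (subst (asm) AE_distr_iff[OF Ym]) auto
  have ZS: "AE \<omega> in M. Z \<omega> \<in> S"
    using S(3) unfolding Zd[symmetric] by (subst (asm) AE_distr_iff[OF Zm]) auto
  have in_lp: "W \<in> lp_space M p" if "W \<in> borel_measurable M" "AE \<omega> in M. W \<omega> \<in> S" for W
  proof -
    note [measurable] = that(1)
    have "integrable M (\<lambda>\<omega>. \<bar>W \<omega>\<bar> powr p)"
    proof (rule integrable_const_bound[where B="B powr p"])
      show "AE \<omega> in M. norm (\<bar>W \<omega>\<bar> powr p) \<le> B powr p"
        using that(2) by eventually_elim (use B assms(3) in \<open>auto intro!: powr_mono2\<close>)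
    qed simp
    then show ?thesis unfolding lp_space_def by simp
  qed
  define q where "q A = (\<Sum>a\<in>A. measure Q' {a})" for A
  define qs where "qs n A = (\<Sum>a\<in>A. measure (Q n) {a})" for n A
  \<comment> \<open>Only finitely many thresholds have to be avoided. Without equality, the strict
    order between \<open>U \<omega>\<close> and \<open>q A\<close> passes to \<open>qs n A\<close>
    for all large \<open>n\<close>.\<close>
  have "AE \<omega> in M. \<forall>A\<in>Pow S. U \<omega> \<noteq> q A"
    using S unit_uniform_AE_neq[OF assms(1) U] by (intro AE_finite_allI) auto
  then have ev: "AE \<omega> in M. \<forall>\<^sub>F n in sequentially. Y n \<omega> = Z \<omega>"
  proof eventually_elim
    fix \<omega> assume \<omega>: "\<forall>A\<in>Pow S. U \<omega> \<noteq> q A"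
    have "\<forall>\<^sub>F n in sequentially. U \<omega> \<le> qs n A \<longleftrightarrow> U \<omega> \<le> q A" if "A \<in> Pow S" for A
    proof -
      have l: "(\<lambda>n. qs n A) \<longlonglongrightarrow> q A"
        unfolding qs_def q_def using lim that by (intro tendsto_sum) auto
      consider "U \<omega> < q A" | "q A < U \<omega>"
        using bspec[OF \<omega> \<open>A \<in> Pow S\<close>] by linarith
      then show ?thesis
      proof cases
        case 1
        then show ?thesis
          using order_tendstoD(1)[OF l 1] by (auto elim!: eventually_mono)
      next
        case 2
        then show ?thesis
          using order_tendstoD(2)[OF l 2] by (auto elim!: eventually_mono)
      qed
    qed
    then have "\<forall>\<^sub>F n in sequentially. \<forall>A\<in>Pow S. U \<omega> \<le> qs n A \<longleftrightarrow> U \<omega> \<le> q A"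
      using S by (intro eventually_ball_finite) auto
    then show "\<forall>\<^sub>F n in sequentially. Y n \<omega> = Z \<omega>"
    proof eventually_elim
      case (elim n)
      \<comment> \<open>With \<open>A = {a\<in>S. a \<le> x}\<close> the two cdf values are
        \<open>qs n A\<close> and \<open>q A\<close>. As \<open>n\<close> works for all subsets at
        once, it works for all \<open>x\<close>, so the sets under the two infima coincide.\<close>
      have "U \<omega> \<le> cdf (Q n) x \<longleftrightarrow> U \<omega> \<le> cdf Q' x" for x
        using elim[rule_format, of "{a\<in>S. a \<le> x}"] cdf_finite_support[OF Q S(1,2)]
          cdf_finite_support[OF Q' S(1,3)] by (auto simp: qs_def q_def)
      then show ?case
        by (simp add: Y_def Z_def)
    qed
  qed
  \<comment> \<open>Both variables almost surely lie in \<open>S\<close>, hence differ by at most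
    \<open>2 * B\<close>; the integrand is eventually zero at almost every point.\<close>
  have "(\<lambda>n. \<integral>\<omega>. \<bar>Y n \<omega> - Z \<omega>\<bar> powr p \<partial>M) \<longlonglongrightarrow> (\<integral>\<omega>. 0 \<partial>M)"
  proof (rule integral_dominated_convergence)
    show "integrable M (\<lambda>\<omega>. (2 * B) powr p)" by simp
    show "AE \<omega> in M. (\<lambda>n. \<bar>Y n \<omega> - Z \<omega>\<bar> powr p) \<longlonglongrightarrow> 0"
      using ev
    proof eventually_elim
      case (elim \<omega>)
      then have "\<forall>\<^sub>F n in sequentially. \<bar>Y n \<omega> - Z \<omega>\<bar> powr p = 0"
        by eventually_elim simp
      then show ?case
        by (rule tendsto_eventually)
    qed
    show "AE \<omega> in M. norm (\<bar>Y n \<omega> - Z \<omega>\<bar> powr p) \<le> (2 * B) powr p" for n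
      using YS[of n] ZS
    proof eventually_elim
      case (elim \<omega>)
      then show ?case
        using B[of "Y n \<omega>"] B[of "Z \<omega>"] assms(3) by (auto intro!: powr_mono2)
    qed
  qed auto
  then have norm0: "(\<lambda>n. lp_norm M p (\<lambda>\<omega>. Y n \<omega> - Z \<omega>)) \<longlonglongrightarrow> 0"
    using assms(3) by (intro lp_norm_tendsto_0) auto
  obtain L where L: "\<And>V W. V \<in> lp_space M p \<Longrightarrow> W \<in> lp_space M p \<Longrightarrow>
      \<bar>\<rho> V - \<rho> W\<bar> \<le> L * lp_norm M p (\<lambda>\<omega>. V \<omega> - W \<omega>)"
    using assms(5) unfolding lp_lipschitz_def by blast
  have "(\<lambda>n. \<rho> (Y n)) \<longlonglongrightarrow> \<rho> Z"
  proof (rule LIM_zero_cancel, rule Lim_null_comparison)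
    show "\<forall>\<^sub>F n in sequentially. norm (\<rho> (Y n) - \<rho> Z) \<le> L * lp_norm M p (\<lambda>\<omega>. Y n \<omega> - Z \<omega>)"
      using L in_lp YS ZS by simp
    show "(\<lambda>n. L * lp_norm M p (\<lambda>\<omega>. Y n \<omega> - Z \<omega>)) \<longlonglongrightarrow> 0"
      using tendsto_mult_right_zero[OF norm0] .
  qed
  then show ?thesis
    using risk_of_distribution_distr[OF assms(4) in_lp[OF Ym YS]]
      risk_of_distribution_distr[OF assms(4) in_lp[OF Zm ZS]] by (simp add: Yd Zd)
qed


section \<open>Local approximation of the integrands by one simple function\<close>

text \<open>Constants are integrable on a probability space, and |y|^p is at most 1 + |y|^q.\<close>

lemma lp_space_antimono:
  assumes "prob_space M" "0 \<le> p" "p \<le> q" "Y \<in> lp_space M q"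
  shows "Y \<in> lp_space M p"
proof -
  interpret prob_space M by fact
  have [measurable]: "Y \<in> borel_measurable M" and i: "integrable M (\<lambda>\<omega>. \<bar>Y \<omega>\<bar> powr q)"
    using assms(4) unfolding lp_space_def by auto
  have "integrable M (\<lambda>\<omega>. \<bar>Y \<omega>\<bar> powr p)"
  proof (rule Bochner_Integration.integrable_bound)
    show "integrable M (\<lambda>\<omega>. 1 + \<bar>Y \<omega>\<bar> powr q)"
      using i by simp
    have "\<bar>Y \<omega>\<bar> powr p \<le> 1 + \<bar>Y \<omega>\<bar> powr q" for \<omega>
    proof (cases "\<bar>Y \<omega>\<bar> \<le> 1")
      case True
      then have "\<bar>Y \<omega>\<bar> powr p \<le> 1"
        using powr_mono2[OF assms(2) _ True] by simp
      then show ?thesis by (simp add: add_increasing2)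
    next
      case False
      then show ?thesis
        using powr_mono[OF assms(3), of "\<bar>Y \<omega>\<bar>"] by linarith
    qed
    then show "AE \<omega> in M. norm (\<bar>Y \<omega>\<bar> powr p) \<le> norm (1 + \<bar>Y \<omega>\<bar> powr q)"
      by (intro AE_I2) (simp add: abs_of_nonneg add_nonneg_nonneg)
  qed simp
  then show ?thesis unfolding lp_space_def by simp
qed

text \<open>The union of finite nets of radius 1/(n+1). It serves to replace suprema over balls of
  \<open>X\<close> by countable suprema, which are measurable.\<close>

lemma compact_countable_dense:
  fixes X :: "'x::metric_space set"
  assumes "compact X"
  obtains D where "countable D" "D \<subseteq> X" "\<And>y e. y \<in> X \<Longrightarrow> 0 < e \<Longrightarrow> \<exists>d\<in>D. dist y d < e"
proof -
  have "\<exists>K\<subseteq>X. finite K \<and> X \<subseteq> (\<Union>x\<in>K. ball x (1 / real (Suc n)))" for n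
    by (rule compactE_image[OF assms, of X "\<lambda>x. ball x (1 / real (Suc n))"]) auto
  then obtain K where K: "\<And>n. K n \<subseteq> X" "\<And>n. finite (K n)"
    "\<And>n. X \<subseteq> (\<Union>x\<in>K n. ball x (1 / real (Suc n)))"
    by metis
  show thesis
  proof (rule that[of "\<Union>n. K n"])
    show "countable (\<Union>n. K n)"
      using K(2) by (simp add: countable_finite)
    show "(\<Union>n. K n) \<subseteq> X"
      using K(1) by blast
    fix y e assume "y \<in> X" "0 < (e::real)"
    obtain n where n: "1 / real (Suc n) < e"
      using nat_approx_posE[OF \<open>0 < e\<close>] by blast
    obtain d where "d \<in> K n" "dist d y < 1 / real (Suc n)"
      using K(3)[of n] \<open>y \<in> X\<close> by auto
    then show "\<exists>d\<in>\<Union>n. K n. dist y d < e"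
      using n by (auto simp: dist_commute intro!: exI[of _ n] bexI[of _ d])
  qed
qed

text \<open>Simple functions \<open>s n\<close> converge to \<open>F x\<close> while the balls
  around \<open>x\<close> shrink, and \<open>h n\<close> is the worst distance from
  \<open>s n\<close> over the n-th ball. Continuity in the first argument sends \<open>h n\<close>
  to 0 pointwise, and \<open>3 * \<kappa>\<close> dominates it, so the mean of
  \<open>h n powr p\<close> tends to 0; \<open>\<phi>\<close> is this power for one large
  \<open>n\<close>.\<close>

lemma local_simple_approximation:
  fixes F :: "'x::metric_space \<Rightarrow> 's::metric_space \<Rightarrow> real"
  assumes "prob_space M" and [measurable]: "\<xi> \<in> measurable M borel"
    and p: "1 \<le> p" "0 \<le> \<epsilon>"
    and X: "compact X" "x \<in> X" and F: "caratheodory X F"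
    and [measurable]: "\<kappa> \<in> borel_measurable borel" and \<kappa>: "(\<lambda>\<omega>. \<kappa> (\<xi> \<omega>)) \<in> lp_space M (p + \<epsilon>)"
      "\<And>x \<upsilon>. x \<in> X \<Longrightarrow> \<bar>F x \<upsilon>\<bar> \<le> \<kappa> \<upsilon>"
    and "0 < \<eta>"
  shows "\<exists>r>0. \<exists>g\<in>borel_measurable borel. \<exists>\<phi>\<in>borel_measurable borel. finite (range g) \<and>
    (\<forall>y\<in>X. dist y x < r \<longrightarrow> (\<forall>\<upsilon>. \<bar>F y \<upsilon> - g \<upsilon>\<bar> powr p \<le> \<phi> \<upsilon>)) \<and>
    (\<lambda>\<omega>. \<phi> (\<xi> \<omega>)) \<in> lp_space M (1 + \<epsilon> / p) \<and> (\<integral>\<omega>. \<phi> (\<xi> \<omega>) \<partial>M) < \<eta>"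
proof -
  interpret prob_space M by fact
  have Fm[measurable]: "F y \<in> borel_measurable borel" if "y \<in> X" for y
    using F that unfolding caratheodory_def by blast
  have Fc: "continuous_on X (\<lambda>y. F y \<upsilon>)" for \<upsilon>
    using F unfolding caratheodory_def by blast
  obtain D where D: "countable D" "D \<subseteq> X" "\<And>y e. y \<in> X \<Longrightarrow> 0 < e \<Longrightarrow> \<exists>d\<in>D. dist y d < e"
    using compact_countable_dense[OF X(1)] by metis
  \<comment> \<open>Approximation relative to the base point 0 supplies the factor 2 in the
    bound.\<close>
  obtain s where s: "\<And>n. simple_function borel (s n)" "\<And>\<upsilon>. (\<lambda>n. s n \<upsilon>) \<longlonglongrightarrow> F x \<upsilon>"
    "\<And>n \<upsilon>. \<bar>s n \<upsilon>\<bar> \<le> 2 * \<bar>F x \<upsilon>\<bar>"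
    using borel_measurable_implies_sequence_metric[OF Fm[OF X(2)], of 0]
    by (auto simp: dist_real_def)
  have sm[measurable]: "s n \<in> borel_measurable borel" for n
    using s(1) by (rule borel_measurable_simple_function)
  \<comment> \<open>The centre \<open>x\<close> is inserted so that the set is nonempty, as the
    conditional supremum in \<open>h\<close> demands, and so that \<open>h n\<close> is
    nonnegative.\<close>
  define DD where "DD n = {d\<in>insert x D. dist d x < 1 / real (Suc n)}" for n
  have DD: "countable (DD n)" "x \<in> DD n" "DD n \<subseteq> X" for n
  proof -
    show "countable (DD n)"
      by (rule countable_subset[of _ "insert x D"]) (use D(1) in \<open>auto simp: DD_def\<close>)
  qed (use D X in \<open>auto simp: DD_def\<close>)
  define h where "h n \<upsilon> = (SUP d\<in>DD n. \<bar>F d \<upsilon> - s n \<upsilon>\<bar>)" for n \<upsilon>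
  have le3: "\<bar>F d \<upsilon> - s n \<upsilon>\<bar> \<le> 3 * \<kappa> \<upsilon>" if "d \<in> X" for d n \<upsilon>
    using \<kappa>(2)[OF that, of \<upsilon>] \<kappa>(2)[OF X(2), of \<upsilon>] s(3)[of n \<upsilon>] by linarith
  have bdd: "bdd_above ((\<lambda>d. \<bar>F d \<upsilon> - s n \<upsilon>\<bar>) ` DD n)" for n \<upsilon>
    using le3 DD(3) by (intro bdd_aboveI2[where M="3 * \<kappa> \<upsilon>"]) blast
  have hD: "\<bar>F d \<upsilon> - s n \<upsilon>\<bar> \<le> h n \<upsilon>" if "d \<in> DD n" for d n \<upsilon>
    unfolding h_def using that bdd by (intro cSUP_upper)
  have h0: "0 \<le> h n \<upsilon>" for n \<upsilon>
    using hD[OF DD(2), of \<upsilon> n] by linarith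
  have h3: "h n \<upsilon> \<le> 3 * \<kappa> \<upsilon>" for n \<upsilon>
    unfolding h_def using le3 DD by (intro cSUP_least) blast+
  have hm[measurable]: "h n \<in> borel_measurable borel" for n
    unfolding h_def[abs_def]
  proof (rule borel_measurable_cSUP)
    show "(\<lambda>\<upsilon>. \<bar>F d \<upsilon> - s n \<upsilon>\<bar>) \<in> borel_measurable borel" if "d \<in> DD n" for d
      using Fm[of d] DD(3)[of n] that by (auto intro!: borel_measurable_abs borel_measurable_diff sm)
  qed (use DD bdd in auto)
  \<comment> \<open>The supremum runs over countably many points only; density and continuity extend
    the bound to the whole ball up to any \<open>e\<close>. The radius
    \<open>1 / real (Suc n) - dist y x\<close> keeps the chosen \<open>d\<close> inside the
    ball.\<close>
  have hX: "\<bar>F y \<upsilon> - s n \<upsilon>\<bar> \<le> h n \<upsilon>" if y: "y \<in> X" "dist y x < 1 / real (Suc n)" for y n \<upsilon>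
  proof (rule field_le_epsilon)
    fix e :: real assume "0 < e"
    obtain \<delta> where \<delta>: "0 < \<delta>" "\<And>d. d \<in> X \<Longrightarrow> dist d y < \<delta> \<Longrightarrow> dist (F d \<upsilon>) (F y \<upsilon>) < e"
      using Fc[of \<upsilon>] y \<open>0 < e\<close> unfolding continuous_on_iff by metis
    obtain d where d: "d \<in> D" "dist y d < min \<delta> (1 / real (Suc n) - dist y x)"
      using D(3)[OF y(1), of "min \<delta> (1 / real (Suc n) - dist y x)"] \<delta> y by auto
    have "dist d x \<le> dist y d + dist y x"
      by (metis dist_commute dist_triangle)
    then have "d \<in> DD n"
      using d unfolding DD_def by auto
    moreover have "\<bar>F d \<upsilon> - F y \<upsilon>\<bar> < e"
      using \<delta>(2)[of d] d D(2) by (auto simp: dist_real_def dist_commute)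
    ultimately show "\<bar>F y \<upsilon> - s n \<upsilon>\<bar> \<le> h n \<upsilon> + e"
      using hD[of d n \<upsilon>] by linarith
  qed
  have hlim: "(\<lambda>n. h n \<upsilon>) \<longlonglongrightarrow> 0" for \<upsilon>
  proof (rule tendstoI)
    fix e :: real assume "0 < e"
    then have e: "0 < e / 3" by simp
    obtain \<delta> where \<delta>: "0 < \<delta>" "\<And>d. d \<in> X \<Longrightarrow> dist d x < \<delta> \<Longrightarrow> dist (F d \<upsilon>) (F x \<upsilon>) < e / 3"
      using Fc[of \<upsilon>] X(2) e unfolding continuous_on_iff by metis
    have "\<forall>\<^sub>F n in sequentially. 1 / real (Suc n) < \<delta>"
      using order_tendstoD(2)[OF LIMSEQ_inverse_real_of_nat \<delta>(1)] by (simp add: inverse_eq_divide)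
    moreover have "\<forall>\<^sub>F n in sequentially. dist (s n \<upsilon>) (F x \<upsilon>) < e / 3"
      using tendstoD[OF s(2) e] .
    ultimately show "\<forall>\<^sub>F n in sequentially. dist (h n \<upsilon>) 0 < e"
    proof eventually_elim
      case (elim n)
      \<comment> \<open>One third comes from moving \<open>d\<close> to \<open>x\<close>, another
        from moving \<open>F x\<close> to \<open>s n\<close>; the last one makes the final
        inequality strict after the supremum.\<close>
      have "h n \<upsilon> \<le> 2 * e / 3"
        unfolding h_def
      proof (rule cSUP_least)
        fix d assume d: "d \<in> DD n"
        then have "dist (F d \<upsilon>) (F x \<upsilon>) < e / 3"
          using \<delta>(2)[of d] elim(1) DD(3)[of n] by (auto simp: DD_def)
        then show "\<bar>F d \<upsilon> - s n \<upsilon>\<bar> \<le> 2 * e / 3"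
          using elim(2) unfolding dist_real_def by linarith
      qed (use DD(2) in blast)
      then show ?case
        using h0[of n \<upsilon>] \<open>0 < e\<close> by (simp add: dist_real_def)
    qed
  qed
  have \<kappa>0: "0 \<le> \<kappa> \<upsilon>" for \<upsilon>
    using \<kappa>(2)[OF X(2), of \<upsilon>] by linarith
  have "(\<lambda>\<omega>. \<kappa> (\<xi> \<omega>)) \<in> lp_space M p"
    using p \<kappa>(1) by (intro lp_space_antimono[OF assms(1), of p "p + \<epsilon>"]) auto
  then have \<kappa>p: "integrable M (\<lambda>\<omega>. \<kappa> (\<xi> \<omega>) powr p)"
    using \<kappa>0 by (simp add: lp_space_def)
  have \<kappa>e: "integrable M (\<lambda>\<omega>. \<kappa> (\<xi> \<omega>) powr (p + \<epsilon>))"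
    using \<kappa>(1) \<kappa>0 by (simp add: lp_space_def)
  have "(\<lambda>n. \<integral>\<omega>. h n (\<xi> \<omega>) powr p \<partial>M) \<longlonglongrightarrow> (\<integral>\<omega>. 0 \<partial>M)"
  proof (rule integral_dominated_convergence)
    show "integrable M (\<lambda>\<omega>. 3 powr p * \<kappa> (\<xi> \<omega>) powr p)"
      using \<kappa>p by simp
    show "AE \<omega> in M. (\<lambda>n. h n (\<xi> \<omega>) powr p) \<longlonglongrightarrow> 0"
    proof (rule AE_I2)
      fix \<omega>
      have "(\<lambda>n. h n (\<xi> \<omega>) powr p) \<longlonglongrightarrow> 0 powr p"
        using p h0 by (intro tendsto_powr' hlim) auto
      then show "(\<lambda>n. h n (\<xi> \<omega>) powr p) \<longlonglongrightarrow> 0"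
        using p by simp
    qed
    show "AE \<omega> in M. norm (h n (\<xi> \<omega>) powr p) \<le> 3 powr p * \<kappa> (\<xi> \<omega>) powr p" for n
      using powr_mono2[OF _ h0 h3, of p n] p \<kappa>0 by (auto simp: powr_mult)
  qed auto
  from order_tendstoD(2)[OF this, of \<eta>] obtain n where n: "(\<integral>\<omega>. h n (\<xi> \<omega>) powr p \<partial>M) < \<eta>"
    using \<open>0 < \<eta>\<close> by (auto dest!: eventually_happens'[OF sequentially_bot])
  show ?thesis
  proof (rule exI[of _ "1 / real (Suc n)"], rule conjI, simp, rule bexI[of _ "s n"],
      rule bexI[of _ "\<lambda>\<upsilon>. h n \<upsilon> powr p"], intro conjI ballI impI allI)
    show "finite (range (s n))"
      using s(1)[of n] by (simp add: simple_function_def)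
    show "\<bar>F y \<upsilon> - s n \<upsilon>\<bar> powr p \<le> h n \<upsilon> powr p" if "y \<in> X" "dist y x < 1 / real (Suc n)" for y \<upsilon>
      using hX[OF that] p by (intro powr_mono2) auto
    \<comment> \<open>Raising \<open>h n powr p\<close> to the power
      \<open>1 + \<epsilon> / p\<close> gives the exponent \<open>p + \<epsilon>\<close>, for which
      \<open>\<kappa>\<close> is integrable. This puts \<open>\<phi>\<close> in the class covered by
      the law of large numbers.\<close>
    have "integrable M (\<lambda>\<omega>. h n (\<xi> \<omega>) powr (p + \<epsilon>))"
    proof (rule Bochner_Integration.integrable_bound)
      show "integrable M (\<lambda>\<omega>. 3 powr (p + \<epsilon>) * \<kappa> (\<xi> \<omega>) powr (p + \<epsilon>))"
        using \<kappa>e by simp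
      show "AE \<omega> in M. norm (h n (\<xi> \<omega>) powr (p + \<epsilon>)) \<le> norm (3 powr (p + \<epsilon>) * \<kappa> (\<xi> \<omega>) powr (p + \<epsilon>))"
        using powr_mono2[OF _ h0 h3, of "p + \<epsilon>" n] p \<kappa>0 by (auto simp: powr_mult)
    qed simp
    moreover have "p * (1 + \<epsilon> / p) = p + \<epsilon>"
      using p by (simp add: field_simps)
    ultimately show "(\<lambda>\<omega>. h n (\<xi> \<omega>) powr p) \<in> lp_space M (1 + \<epsilon> / p)"
      by (simp add: lp_space_def powr_powr)
  qed (use n in auto)
qed


section \<open>Risk under the empirical measure\<close>

text \<open>The majorant bounds the norm of the difference by \<open>e\<close>. The same estimate
  serves the true law and, through the coupling, the empirical one.\<close>

lemma lipschitz_risk_close: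
  assumes "prob_space M" "1 \<le> p"
    and L: "\<And>V W. V \<in> lp_space M p \<Longrightarrow> W \<in> lp_space M p \<Longrightarrow>
      \<bar>\<rho> V - \<rho> W\<bar> \<le> L * lp_norm M p (\<lambda>\<omega>. V \<omega> - W \<omega>)" "0 \<le> L"
    and V: "V \<in> lp_space M p" and W: "W \<in> lp_space M p"
    and \<phi>: "\<And>\<omega>. \<bar>V \<omega> - W \<omega>\<bar> powr p \<le> \<phi> \<omega>" "integrable M \<phi>" "(\<integral>\<omega>. \<phi> \<omega> \<partial>M) \<le> e powr p"
    and "0 \<le> e"
  shows "\<bar>\<rho> V - \<rho> W\<bar> \<le> L * e"
proof -
  have [measurable]: "V \<in> borel_measurable M" "W \<in> borel_measurable M"
    using V W by (auto simp: lp_space_def)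
  have "integrable M (\<lambda>\<omega>. \<bar>V \<omega> - W \<omega>\<bar> powr p)"
    by (rule Bochner_Integration.integrable_bound[OF \<phi>(2)]) (auto intro!: AE_I2 order_trans[OF \<phi>(1)])
  then have "(\<integral>\<omega>. \<bar>V \<omega> - W \<omega>\<bar> powr p \<partial>M) \<le> (\<integral>\<omega>. \<phi> \<omega> \<partial>M)"
    using \<phi> by (intro integral_mono)
  then have "lp_norm M p (\<lambda>\<omega>. V \<omega> - W \<omega>) \<le> e"
    using \<phi>(3) assms(2) \<open>0 \<le> e\<close> by (intro lp_norm_le) auto
  then show ?thesis
    using L(1)[OF V W] mult_left_mono[OF _ L(2), of "lp_norm M p (\<lambda>\<omega>. V \<omega> - W \<omega>)" e] by linarith
qed

lemma distr_empirical_measure: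
  assumes T: "T \<in> measurable M borel" "distr M borel T = empirical_measure N s"
    and "f \<in> borel_measurable borel"
  shows "distr (empirical_measure N s) borel f = distr M borel (\<lambda>\<omega>. f (T \<omega>))"
  unfolding T(2)[symmetric] using T(1) assms(3) by (simp add: distr_distr comp_def)

text \<open>Under the coupling \<open>T\<close> the integral of \<open>\<phi> (T \<omega>)\<close>
  is the empirical mean of \<open>\<phi>\<close>, so the Lipschitz estimate on \<open>M\<close>
  applies to the two empirical laws.\<close>

lemma risk_empirical_close:
  fixes f :: "'s::metric_space \<Rightarrow> real" and s :: "nat \<Rightarrow> 's"
  assumes "prob_space M" "nonatomic M" "1 \<le> p" "law_invariant M p \<rho>"
    and L: "\<And>V W. V \<in> lp_space M p \<Longrightarrow> W \<in> lp_space M p \<Longrightarrow>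
      \<bar>\<rho> V - \<rho> W\<bar> \<le> L * lp_norm M p (\<lambda>\<omega>. V \<omega> - W \<omega>)" "0 \<le> L"
    and [measurable]: "f \<in> borel_measurable borel" "g \<in> borel_measurable borel" "\<phi> \<in> borel_measurable borel"
    and \<phi>: "\<And>\<upsilon>. \<bar>f \<upsilon> - g \<upsilon>\<bar> powr p \<le> \<phi> \<upsilon>"
    and "0 < N" "(1 / real N) * (\<Sum>i=1..N. \<phi> (s i)) \<le> e powr p" "0 \<le> e"
  shows "\<bar>risk_of_distribution M p \<rho> (distr (empirical_measure N s) borel f) -
    risk_of_distribution M p \<rho> (distr (empirical_measure N s) borel g)\<bar> \<le> L * e"
proof -
  interpret prob_space M by fact
  obtain T where T[measurable]: "T \<in> measurable M borel"
    and dT: "distr M borel T = empirical_measure N s"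
    and rT: "\<And>\<omega>. \<omega> \<in> space M \<Longrightarrow> T \<omega> \<in> s ` {1..N}"
    and iT: "\<And>h. (\<integral>\<omega>. h (T \<omega>) \<partial>M) = (1 / real N) * (\<Sum>i=1..N. h (s i) :: real)"
    using empirical_coupling[OF assms(1,2) \<open>0 < N\<close>] by metis
  \<comment> \<open>\<open>T\<close> takes finitely many values, so every real function of it is
    bounded.\<close>
  have bd: "\<bar>h (T \<omega>)\<bar> \<le> Max ((\<lambda>i. \<bar>h (s i)\<bar>) ` {1..N})" if "\<omega> \<in> space M"
    for h :: "'s \<Rightarrow> real" and \<omega>
    using rT[OF that] by (auto intro!: Max_ge)
  have lp: "(\<lambda>\<omega>. h (T \<omega>)) \<in> lp_space M p" if [measurable]: "h \<in> borel_measurable borel"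
    for h :: "'s \<Rightarrow> real"
    using bd[of _ h] assms(3) by (intro bounded_in_lp_space[OF assms(1)]) auto
  have "\<bar>\<rho> (\<lambda>\<omega>. f (T \<omega>)) - \<rho> (\<lambda>\<omega>. g (T \<omega>))\<bar> \<le> L * e"
  proof (rule lipschitz_risk_close[where \<phi>="\<lambda>\<omega>. \<phi> (T \<omega>)", OF assms(1,3) L])
    show "integrable M (\<lambda>\<omega>. \<phi> (T \<omega>))"
      using bd[of _ \<phi>] by (intro integrable_const_bound) auto
    show "(\<integral>\<omega>. \<phi> (T \<omega>) \<partial>M) \<le> e powr p"
      using assms(12) iT[of \<phi>] by simp
  qed (use \<phi> lp \<open>0 \<le> e\<close> in auto)
  then show ?thesis
    by (simp add: distr_empirical_measure[OF T dT] risk_of_distribution_distr[OF assms(4) lp])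
qed

text \<open>The law of \<open>g\<close> lives on the finite set \<open>range g\<close> and its point
  masses are relative frequencies, so the assumed limits are convergence atom by atom.\<close>

lemma risk_empirical_tendsto_simple:
  fixes g :: "'s::metric_space \<Rightarrow> real" and s :: "nat \<Rightarrow> 's"
  assumes "prob_space M" "nonatomic M" "1 \<le> p" "law_invariant M p \<rho>" "lp_lipschitz M p \<rho>"
    and [measurable]: "\<xi> \<in> measurable M borel" and g[measurable]: "g \<in> borel_measurable borel"
    and fin: "finite (range g)"
    and lim: "\<And>a. a \<in> range g \<Longrightarrow>
      (\<lambda>N. (1 / real N) * (\<Sum>i=1..N. indicator {a} (g (s i)))) \<longlonglongrightarrow> (\<integral>\<omega>. indicator {a} (g (\<xi> \<omega>)) \<partial>M)"
  shows "(\<lambda>N. risk_of_distribution M p \<rho> (distr (empirical_measure N s) borel g)) \<longlonglongrightarrow> \<rho> (\<lambda>\<omega>. g (\<xi> \<omega>))"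
proof -
  interpret prob_space M by fact
  have ind: "measure (distr M borel (\<lambda>\<omega>. g (T \<omega>))) {a} = (\<integral>\<omega>. indicator {a} (g (T \<omega>)) \<partial>M)"
    if [measurable]: "T \<in> measurable M borel" for T and a :: real
  proof -
    have "(\<integral>\<omega>. indicator {a} (g (T \<omega>)) \<partial>M) = (\<integral>x. indicat_real {a} x \<partial>distr M borel (\<lambda>\<omega>. g (T \<omega>)))"
      by (rule integral_distr[symmetric]) auto
    then show ?thesis by simp
  qed
  \<comment> \<open>The index is shifted because \<open>empirical_measure 0 s\<close> is the null
    measure, while the continuity result asks for a probability law at every index;
    \<open>LIMSEQ_imp_Suc\<close> removes the shift.\<close>
  have "(\<lambda>N. risk_of_distribution M p \<rho> (distr (empirical_measure (Suc N) s) borel g))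
      \<longlonglongrightarrow> risk_of_distribution M p \<rho> (distr M borel (\<lambda>\<omega>. g (\<xi> \<omega>)))"
  proof (rule risk_of_distribution_tendsto_finite_support[OF assms(1-5) _ _ fin])
    show "real_distribution (distr (empirical_measure (Suc N) s) borel g)" for N
    proof -
      interpret E: prob_space "empirical_measure (Suc N) s"
        by (rule prob_space_empirical_measure) simp
      show ?thesis
        by (rule E.real_distribution_distr) simp
    qed
    show "real_distribution (distr M borel (\<lambda>\<omega>. g (\<xi> \<omega>)))"
      by simp
    have rng: "range g \<in> sets borel"
      using fin by (intro borel_closed finite_imp_closed)
    show "AE x in distr (empirical_measure (Suc N) s) borel g. x \<in> range g" for N
      by (subst AE_distr_iff) (auto simp: rng)
    show "AE x in distr M borel (\<lambda>\<omega>. g (\<xi> \<omega>)). x \<in> range g"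
      by (subst AE_distr_iff) (auto simp: rng)
    fix a assume a: "a \<in> range g"
    have "measure (distr (empirical_measure (Suc N) s) borel g) {a} =
        (1 / real (Suc N)) * (\<Sum>i=1..Suc N. indicator {a} (g (s i)))" for N
    proof -
      obtain T where T: "T \<in> measurable M borel" "distr M borel T = empirical_measure (Suc N) s"
        "\<And>h. (\<integral>\<omega>. h (T \<omega>) \<partial>M) = (1 / real (Suc N)) * (\<Sum>i=1..Suc N. h (s i) :: real)"
        using empirical_coupling[OF assms(1,2), of "Suc N" s] by (metis zero_less_Suc)
      show ?thesis
        unfolding distr_empirical_measure[OF T(1,2) g] ind[OF T(1)] by (rule T(3))
    qed
    then show "(\<lambda>N. measure (distr (empirical_measure (Suc N) s) borel g) {a})
        \<longlonglongrightarrow> measure (distr M borel (\<lambda>\<omega>. g (\<xi> \<omega>))) {a}"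
      using LIMSEQ_Suc[OF lim[OF a]] by (simp add: ind)
  qed
  moreover have "(\<lambda>\<omega>. g (\<xi> \<omega>)) \<in> lp_space M p"
  proof (rule bounded_in_lp_space[OF assms(1)])
    show "\<bar>g (\<xi> \<omega>)\<bar> \<le> Max (range (\<lambda>\<upsilon>. \<bar>g \<upsilon>\<bar>))" for \<omega>
      using finite_imageI[OF fin, of abs] by (intro Max_ge) (auto simp: image_image)
  qed (use assms(3) in auto)
  ultimately show ?thesis
    using assms(4) by (simp add: risk_of_distribution_distr LIMSEQ_imp_Suc)
qed


section \<open>Local error bounds, compactness and the choice of one null set\<close>

theorem theorem3:
  fixes M :: "'w measure" and \<Theta> :: "'t measure"
    and X :: "'x::metric_space set"
    and \<xi> :: "'w \<Rightarrow> 's::metric_space" and \<xi>s :: "nat \<Rightarrow> 't \<Rightarrow> 's"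
    and F :: "'x \<Rightarrow> 's \<Rightarrow> real" and \<kappa> :: "'s \<Rightarrow> real"
    and \<rho> :: "('w \<Rightarrow> real) \<Rightarrow> real" and p \<epsilon> :: real
  assumes "prob_space M" "complete_measure M" "nonatomic M"
    and "separable_space (euclidean :: 's topology)"
    and "\<xi> \<in> measurable M borel"
    and "1 \<le> p" "0 \<le> \<epsilon>"
    and "compact X"
    and "caratheodory X F"
    and "lp_continuous_on M p X (\<lambda>x \<omega>. F x (\<xi> \<omega>))"
    and "\<kappa> \<in> borel_measurable borel" "(\<lambda>\<omega>. \<kappa> (\<xi> \<omega>)) \<in> lp_space M (p + \<epsilon>)"
      "\<And>x \<upsilon>. x \<in> X \<Longrightarrow> \<bar>F x \<upsilon>\<bar> \<le> \<kappa> \<upsilon>"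
    and "convex_risk_measure M p \<rho>" "law_invariant M p \<rho>" "lp_lipschitz M p \<rho>"
    and "prob_space \<Theta>" "\<And>i. i \<ge> 1 \<Longrightarrow> \<xi>s i \<in> measurable \<Theta> borel"
    and "\<And>\<phi> :: 's \<Rightarrow> real. \<phi> \<in> borel_measurable borel \<Longrightarrow>
      (\<lambda>\<omega>. \<phi> (\<xi> \<omega>)) \<in> lp_space M (1 + \<epsilon> / p) \<Longrightarrow>
      AE \<theta> in \<Theta>. (\<lambda>N. (1 / real N) * (\<Sum>i=1..N. \<phi> (\<xi>s i \<theta>))) \<longlonglongrightarrow> (\<integral>\<omega>. \<phi> (\<xi> \<omega>) \<partial>M)"
  shows "AE \<theta> in \<Theta>. (\<lambda>N. SUP x\<in>X. ennreal \<bar>risk_of_distribution M p \<rho>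
      (distr (empirical_measure N (\<lambda>i. \<xi>s i \<theta>)) borel (F x)) - \<rho> (\<lambda>\<omega>. F x (\<xi> \<omega>))\<bar>) \<longlonglongrightarrow> 0"
proof -
  interpret M: prob_space M by fact
  interpret \<Theta>: prob_space \<Theta> by fact
  note [measurable] = \<open>\<xi> \<in> measurable M borel\<close>
  note p = \<open>1 \<le> p\<close> and law = \<open>law_invariant M p \<rho>\<close>
  have lln: "AE \<theta> in \<Theta>. (\<lambda>N. (1 / real N) * (\<Sum>i=1..N. \<phi> (\<xi>s i \<theta>))) \<longlonglongrightarrow> (\<integral>\<omega>. \<phi> (\<xi> \<omega>) \<partial>M)"
    if "\<phi> \<in> borel_measurable borel" "(\<lambda>\<omega>. \<phi> (\<xi> \<omega>)) \<in> lp_space M (1 + \<epsilon> / p)" for \<phi>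
    using that by fact
  have Fm: "F y \<in> borel_measurable borel" if "y \<in> X" for y
    using \<open>caratheodory X F\<close> that unfolding caratheodory_def by blast
  have Flp: "(\<lambda>\<omega>. F y (\<xi> \<omega>)) \<in> lp_space M p" if "y \<in> X" for y
    using \<open>lp_continuous_on M p X (\<lambda>x \<omega>. F x (\<xi> \<omega>))\<close> that unfolding lp_continuous_on_def by blast
  obtain L where L: "0 \<le> L" "\<And>V W. V \<in> lp_space M p \<Longrightarrow> W \<in> lp_space M p \<Longrightarrow>
      \<bar>\<rho> V - \<rho> W\<bar> \<le> L * lp_norm M p (\<lambda>\<omega>. V \<omega> - W \<omega>)"
    using \<open>lp_lipschitz M p \<rho>\<close> unfolding lp_lipschitz_def by blast
  define err where "err \<theta> N y = \<bar>risk_of_distribution M p \<rho>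
      (distr (empirical_measure N (\<lambda>i. \<xi>s i \<theta>)) borel (F y)) - \<rho> (\<lambda>\<omega>. F y (\<xi> \<omega>))\<bar>" for \<theta> N y
  \<comment> \<open>The exceptional set depends on \<open>x\<close> and \<open>e\<close> but not on
    \<open>y\<close>. The factor collects \<open>L * e\<close> for replacing \<open>F y\<close> by
    \<open>g\<close> under the empirical law, \<open>L * e\<close> for doing so under the true law,
    and \<open>e\<close> for the convergence of the risk of \<open>g\<close>.\<close>
  have loc: "\<exists>r>0. AE \<theta> in \<Theta>. \<forall>\<^sub>F N in sequentially. \<forall>y\<in>X. dist y x < r \<longrightarrow> err \<theta> N y \<le> (2 * L + 1) * e"
    if x: "x \<in> X" and e: "0 < e" for x e
  proof -
    obtain r g \<phi> where r: "0 < r" and g[measurable]: "g \<in> borel_measurable borel" and fin: "finite (range g)"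
      and \<phi>[measurable]: "\<phi> \<in> borel_measurable borel"
      and le: "\<And>y \<upsilon>. y \<in> X \<Longrightarrow> dist y x < r \<Longrightarrow> \<bar>F y \<upsilon> - g \<upsilon>\<bar> powr p \<le> \<phi> \<upsilon>"
      and \<phi>lp: "(\<lambda>\<omega>. \<phi> (\<xi> \<omega>)) \<in> lp_space M (1 + \<epsilon> / p)"
      and \<phi>e: "(\<integral>\<omega>. \<phi> (\<xi> \<omega>) \<partial>M) < e powr p"
      using local_simple_approximation[OF assms(1,5,6,7,8) x assms(9,11,12,13), of "e powr p"] e by auto
    have ilp: "(\<lambda>\<omega>. indicator {a} (g (\<xi> \<omega>))) \<in> lp_space M (1 + \<epsilon> / p)" for a
      using p \<open>0 \<le> \<epsilon>\<close> by (intro bounded_in_lp_space[OF assms(1), where B=1]) (auto simp: indicator_def)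
    have glp: "(\<lambda>\<omega>. g (\<xi> \<omega>)) \<in> lp_space M p"
    proof (rule bounded_in_lp_space[OF assms(1)])
      show "\<bar>g (\<xi> \<omega>)\<bar> \<le> Max (range (\<lambda>\<upsilon>. \<bar>g \<upsilon>\<bar>))" for \<omega>
        using finite_imageI[OF fin, of abs] by (intro Max_ge) (auto simp: image_image)
    qed (use p in auto)
    have \<phi>int: "integrable M (\<lambda>\<omega>. \<phi> (\<xi> \<omega>))"
    proof -
      have "(\<lambda>\<omega>. \<phi> (\<xi> \<omega>)) \<in> lp_space M 1"
        using p \<open>0 \<le> \<epsilon>\<close> by (intro lp_space_antimono[OF assms(1) _ _ \<phi>lp]) auto
      then have "integrable M (\<lambda>\<omega>. \<bar>\<phi> (\<xi> \<omega>)\<bar>)"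
        by (simp add: lp_space_def)
      then show ?thesis
        by (rule integrable_abs_cancel) measurable
    qed
    \<comment> \<open>The law of large numbers is used for finitely many functions: the indicators
      of the values of \<open>g\<close>, and \<open>\<phi>\<close>.\<close>
    have "AE \<theta> in \<Theta>. \<forall>a\<in>range g. (\<lambda>N. (1 / real N) * (\<Sum>i=1..N. indicator {a} (g (\<xi>s i \<theta>))))
        \<longlonglongrightarrow> (\<integral>\<omega>. indicator {a} (g (\<xi> \<omega>)) \<partial>M)"
      by (intro AE_finite_allI[OF fin] lln ilp) measurable
    moreover have "AE \<theta> in \<Theta>. (\<lambda>N. (1 / real N) * (\<Sum>i=1..N. \<phi> (\<xi>s i \<theta>))) \<longlonglongrightarrow> (\<integral>\<omega>. \<phi> (\<xi> \<omega>) \<partial>M)"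
      by (intro lln \<phi>lp \<phi>)
    ultimately have "AE \<theta> in \<Theta>. \<forall>\<^sub>F N in sequentially. \<forall>y\<in>X. dist y x < r \<longrightarrow> err \<theta> N y \<le> (2 * L + 1) * e"
    proof eventually_elim
      case (elim \<theta>)
      let ?R = "\<lambda>N f. risk_of_distribution M p \<rho> (distr (empirical_measure N (\<lambda>i. \<xi>s i \<theta>)) borel f)"
      have "(\<lambda>N. ?R N g) \<longlonglongrightarrow> \<rho> (\<lambda>\<omega>. g (\<xi> \<omega>))"
        using elim(1) by (intro risk_empirical_tendsto_simple[OF assms(1,3,6,15,16,5) g fin]) blast
      then have "\<forall>\<^sub>F N in sequentially. dist (?R N g) (\<rho> (\<lambda>\<omega>. g (\<xi> \<omega>))) < e"
        using e by (rule tendstoD)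
      moreover have "\<forall>\<^sub>F N in sequentially. (1 / real N) * (\<Sum>i=1..N. \<phi> (\<xi>s i \<theta>)) < e powr p"
        using order_tendstoD(2)[OF elim(2) \<phi>e] .
      ultimately show ?case
        using eventually_gt_at_top[of 0]
      proof eventually_elim
        case (elim N)
        show ?case
        proof (intro ballI impI)
          fix y assume y: "y \<in> X" "dist y x < r"
          have "\<bar>?R N (F y) - ?R N g\<bar> \<le> L * e"
            using elim e by (intro risk_empirical_close[OF assms(1,3) p law L(2,1) Fm[OF y(1)] g \<phi> le[OF y]]) auto
          moreover have "\<bar>\<rho> (\<lambda>\<omega>. F y (\<xi> \<omega>)) - \<rho> (\<lambda>\<omega>. g (\<xi> \<omega>))\<bar> \<le> L * e"
            using \<phi>e e le[OF y]
            by (intro lipschitz_risk_close[OF assms(1) p L(2,1) Flp[OF y(1)] glp _ \<phi>int]) auto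
          ultimately show "err \<theta> N y \<le> (2 * L + 1) * e"
            using elim(1) unfolding err_def dist_real_def by (simp add: algebra_simps)
        qed
      qed
    qed
    then show ?thesis
      using r by blast
  qed
  have glob: "AE \<theta> in \<Theta>. \<forall>\<^sub>F N in sequentially. \<forall>y\<in>X. err \<theta> N y \<le> e" if e: "0 < e" for e
  proof -
    define e' where "e' = e / (2 * L + 1)"
    have e': "0 < e'" "(2 * L + 1) * e' = e"
      using e L(1) by (simp_all add: e'_def)
    then have "\<forall>x\<in>X. \<exists>r. 0 < r \<and> (AE \<theta> in \<Theta>. \<forall>\<^sub>F N in sequentially. \<forall>y\<in>X. dist y x < r \<longrightarrow> err \<theta> N y \<le> e)"
      using loc[OF _ e'(1)] unfolding e'(2) by blast
    from bchoice[OF this] obtain r where r: "\<And>x. x \<in> X \<Longrightarrow> 0 < r x"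
      "\<And>x. x \<in> X \<Longrightarrow> AE \<theta> in \<Theta>. \<forall>\<^sub>F N in sequentially. \<forall>y\<in>X. dist y x < r x \<longrightarrow> err \<theta> N y \<le> e"
      by blast
    \<comment> \<open>A finite subcover keeps the union of the exceptional sets null and allows a
      common threshold for \<open>N\<close>.\<close>
    obtain K where K: "K \<subseteq> X" "finite K" "X \<subseteq> (\<Union>x\<in>K. ball x (r x))"
      by (rule compactE_image[OF \<open>compact X\<close>, of X "\<lambda>x. ball x (r x)"]) (use r(1) in auto)
    have "AE \<theta> in \<Theta>. \<forall>x\<in>K. \<forall>\<^sub>F N in sequentially. \<forall>y\<in>X. dist y x < r x \<longrightarrow> err \<theta> N y \<le> e"
      using K r(2) by (intro AE_finite_allI) auto
    then show ?thesis
    proof eventually_elim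
      case (elim \<theta>)
      have "\<forall>\<^sub>F N in sequentially. \<forall>x\<in>K. \<forall>y\<in>X. dist y x < r x \<longrightarrow> err \<theta> N y \<le> e"
        using K(2) elim by (intro eventually_ball_finite) auto
      then show ?case
      proof eventually_elim
        case (elim N)
        show ?case
        proof
          fix y assume y: "y \<in> X"
          then obtain x where "x \<in> K" "dist y x < r x"
            using K(3) by (auto simp: dist_commute)
          then show "err \<theta> N y \<le> e"
            using elim y by blast
        qed
      qed
    qed
  qed
  \<comment> \<open>Countably many tolerances suffice, and their null sets unite to a null
    set.\<close>
  have "AE \<theta> in \<Theta>. \<forall>k. \<forall>\<^sub>F N in sequentially. \<forall>y\<in>X. err \<theta> N y \<le> 1 / real (Suc k)"
    unfolding AE_all_countable using glob by simp
  then have "AE \<theta> in \<Theta>. (\<lambda>N. SUP y\<in>X. ennreal (err \<theta> N y)) \<longlonglongrightarrow> 0"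
  proof eventually_elim
    case (elim \<theta>)
    show ?case
    proof (rule order_tendstoI)
      fix b :: ennreal assume "0 < b"
      \<comment> \<open>A bound on every error only bounds the supremum weakly; the intermediate
        \<open>c\<close>, finite because it lies below \<open>b\<close>, restores
        strictness.\<close>
      then obtain c where c: "0 < c" "c < b"
        using dense by blast
      then obtain c' where c': "c = ennreal c'" "0 < c'"
        by (cases c) auto
      obtain k where k: "1 / real (Suc k) < c'"
        using nat_approx_posE[OF c'(2)] by blast
      show "\<forall>\<^sub>F N in sequentially. (SUP y\<in>X. ennreal (err \<theta> N y)) < b"
        using elim[rule_format, of k]
      proof eventually_elim
        case (elim N)
        have "(SUP y\<in>X. ennreal (err \<theta> N y)) \<le> c"
          unfolding c' using elim k by (intro SUP_least ennreal_leI) force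
        then show ?case
          using c(2) by (rule le_less_trans)
      qed
    qed simp
  qed
  then show ?thesis
    unfolding err_def .
qed

end
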